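(* Let $M,N\ge 2$ and let $\mathbf A=(a_{j,k})_{j,k=0}^{M-1,N-1}\in\mathbb C^{M\times N}$ satisfy $|a_{0,0}|\ge|a_{M-1,N-1}|$ and $\operatorname{rank}(\mathbf A)\ge 1$. Then an optimal rank-1 Hankel approximation of $\mathbf A$ in the Frobenius norm, i.e. a minimizer of $\|\mathbf A-\mathbf H\|_F$ over all Hankel matrices $\mathbf H\in\mathbb C^{M\times N}$ of rank at most $1$, is given by $\mathbf H_1=\tilde c\,\mathbf z_M(\tilde z)\,\mathbf z_N(\tilde z)^T$ where $$\tilde z\in\mathop{\mathrm{argmax}}_{z\in\mathbb C}\bigl|\mathbf z_M(z)^*\,\mathbf A\,\overline{\mathbf z_N(z)}\bigr|,\qquad \tilde c:=\mathbf z_M(\tilde z)^*\,\mathbf A\,\overline{\mathbf z_N(\tilde z)}.$$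
   Context: For $z\in\mathbb C$ and $n\in\mathbb N$, $\mathbf z_n(z):=\bigl(\sum_{k=0}^{n-1}|z|^{2k}\bigr)^{-1/2}(1,z,z^2,\dots,z^{n-1})^T\in\mathbb C^n$. A matrix $\mathbf H\in\mathbb C^{M\times N}$ is Hankel if $\mathbf H=(h_{k+\ell})_{k,\ell=0}^{M-1,N-1}$ for some numbers $h_0,\dots,h_{M+N-2}\in\mathbb C$. $\overline{\,\cdot\,}$ is entrywise complex conjugation, $\mathbf x^*=\overline{\mathbf x}^T$, and $\|\cdot\|_F$ is the Frobenius norm. *)

theory Defs
  imports Complex_Main "Jordan_Normal_Form.DL_Rank"
begin

text \<open>The structured vector \<open>(\<Sum>k<n. \<bar>z\<bar>\<^bsup>2k\<^esup>)\<^bsup>-1/2\<^esup> (1, z, \<dots>, z\<^bsup>n-1\<^esup>)\<^sup>T\<close>; at \<open>z = 0\<close> it is the first unit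
  vector, because \<open>0 ^ 0 = 1\<close>.\<close>

definition struct_vec :: "nat \<Rightarrow> complex \<Rightarrow> complex vec" where
  "struct_vec n z =
     complex_of_real (1 / sqrt (\<Sum>k<n. cmod z ^ (2 * k))) \<cdot>\<^sub>v vec n (\<lambda>k. z ^ k)"

definition hankel_mat :: "'a mat \<Rightarrow> bool" where
  "hankel_mat H \<longleftrightarrow> (\<exists>h :: nat \<Rightarrow> 'a. H = mat (dim_row H) (dim_col H) (\<lambda>(k, l). h (k + l)))"

definition frobenius_norm :: "complex mat \<Rightarrow> real" where
  "frobenius_norm A = sqrt (\<Sum>j<dim_row A. \<Sum>k<dim_col A. (cmod (A $$ (j, k)))\<^sup>2)"

text \<open>The matrix \<open>u v\<^sup>T\<close> (no conjugation), as the product of a one-column and a one-row matrix.\<close>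

definition outer_prod :: "'a :: comm_ring_1 vec \<Rightarrow> 'a vec \<Rightarrow> 'a mat" where
  "outer_prod u v = mat_of_cols (dim_vec u) [u] * mat_of_rows (dim_vec v) [v]"

text \<open>The number \<open>u\<^sup>* A w\<close> with \<open>u = struct_vec M z\<close> and \<open>w\<close> the conjugate of \<open>struct_vec N z\<close>,
  where \<open>A\<close> is \<open>M \<times> N\<close>. Note that \<open>\<bullet>\<close> is bilinear.\<close>

definition struct_coeff :: "complex mat \<Rightarrow> complex \<Rightarrow> complex" where
  "struct_coeff A z =
     conjugate (struct_vec (dim_row A) z) \<bullet> (A *\<^sub>v conjugate (struct_vec (dim_col A) z))"

text \<open>\<open>H\<close> minimizes the Frobenius distance to \<open>A\<close> among all Hankel matrices of the same size as \<open>A\<close>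
  and of rank at most 1; the first argument of \<open>vec_space.rank\<close> is the number of rows.\<close>

definition optimal_rank1_hankel :: "complex mat \<Rightarrow> complex mat \<Rightarrow> bool" where
  "optimal_rank1_hankel A H \<longleftrightarrow>
     is_arg_min (\<lambda>X. frobenius_norm (A - X))
       (\<lambda>X. X \<in> carrier_mat (dim_row A) (dim_col A) \<and> hankel_mat X \<and>
            vec_space.rank (dim_row A) X \<le> 1) H"

end

theory Submission
  imports "HOL-Analysis.Topology_Euclidean_Space" Defs "Jordan_Normal_Form.DL_Rank_Submatrix"
begin

text \<open>A Hankel matrix of rank at most 1 has vanishing 2 by 2 minors, which makes it a multiple of some
  \<open>z\<^sub>M(z) z\<^sub>N(z)\<^sup>T\<close> or of \<open>e\<^sub>M e\<^sub>N\<^sup>T\<close>, with \<open>e\<^sub>n\<close> the last unit vector; the second case is the limit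
  \<open>z \<rightarrow> \<infinity>\<close> of the first. For unit vectors \<open>u\<close>, \<open>v\<close> the squared distance from \<open>A\<close> to \<open>c u v\<^sup>T\<close> is
  \<open>\<parallel>A\<parallel>\<^sup>2 - \<bar>s\<bar>\<^sup>2 + \<bar>c - s\<bar>\<^sup>2\<close> with \<open>s\<close> the product of \<open>u\<^sup>*\<close>, \<open>A\<close> and the
  conjugate of \<open>v\<close>, so one has to maximize \<open>\<bar>s\<bar>\<close>. Reversing rows and
  columns of \<open>A\<close> corresponds to \<open>z \<mapsto> 1/z\<close>, so the maximization reduces to two closed unit discs; the
  corner hypothesis says that the point at infinity does not beat \<open>z = 0\<close>.\<close>

unbundle no vec_syntax and no inner_syntax

section \<open>Vanishing minors of matrices of rank at most 1\<close>

lemma det_2_by_2: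
  assumes A: "A \<in> carrier_mat 2 2"
  shows "det A = A $$ (0, 0) * A $$ (1, 1) - A $$ (0, 1) * A $$ (1, 0)"
proof -
  have c: "mat_delete A 0 j \<in> carrier_mat 1 1" for j
    using A by (simp add: mat_delete_def)
  have "det A = (\<Sum>j<2. A $$ (0, j) * cofactor A 0 j)"
    by (rule laplace_expansion_row[OF A]) simp
  also have "\<dots> = A $$ (0, 0) * A $$ (1, 1) - A $$ (0, 1) * A $$ (1, 0)"
    using A by (simp add: numeral_2_eq_2 cofactor_def det_single[OF c]) (simp add: mat_delete_def)
  finally show ?thesis .
qed

text \<open>A nonzero 2 by 2 minor forces rank at least 2. The indices are increasing because
  \<open>submatrix\<close> lists the selected rows and columns in increasing order.\<close>

lemma rank_le_1_minor_less:
  assumes X: "X \<in> carrier_mat M N" and r: "vec_space.rank M X \<le> 1"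
    and "i < i'" "i' < M" "j < j'" "j' < N"
  shows "X $$ (i, j) * X $$ (i', j') = X $$ (i, j') * X $$ (i', j)"
proof (rule ccontr)
  assume ne: "\<not> ?thesis"
  let ?S = "submatrix X {i, i'} {j, j'}"
  have ij: "i < M" "j < N"
    using assms(3-6) by linarith+
  have I: "{a. a < M \<and> a \<in> {i, i'}} = {i, i'}"
    using assms(4) ij(1) by blast
  have J: "{b. b < N \<and> b \<in> {j, j'}} = {j, j'}"
    using assms(6) ij(2) by blast
  have two: "card {i, i'} = 2" "card {j, j'} = 2"
    using assms(3,5) by (simp_all add: card_2_iff')
  have S: "?S \<in> carrier_mat 2 2"
    by (rule carrier_matI) (simp_all only: dim_submatrix carrier_matD[OF X] I J two)
  \<comment> \<open>An index sits in the submatrix at the position counting the selected indices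
    below it: 0 for \<open>i\<close> and \<open>j\<close>, 1 for \<open>i'\<close> and
    \<open>j'\<close>.\<close>
  have c: "{a \<in> {i, i'}. a < i} = {}" "{a \<in> {i, i'}. a < i'} = {i}"
    "{a \<in> {j, j'}. a < j} = {}" "{a \<in> {j, j'}. a < j'} = {j}"
    using assms(3,5) by fastforce+
  have e: "?S $$ (0, 0) = X $$ (i, j)" "?S $$ (0, 1) = X $$ (i, j')"
    "?S $$ (1, 0) = X $$ (i', j)" "?S $$ (1, 1) = X $$ (i', j')"
    using submatrix_index_card[of i X j "{i, i'}" "{j, j'}"]
      submatrix_index_card[of i X j' "{i, i'}" "{j, j'}"]
      submatrix_index_card[of i' X j "{i, i'}" "{j, j'}"]
      submatrix_index_card[of i' X j' "{i, i'}" "{j, j'}"]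
      ij assms(4,6) unfolding c carrier_matD[OF X] by simp_all
  have "det ?S \<noteq> 0"
    using ne unfolding det_2_by_2[OF S] e by simp
  then have "card {b. b < N \<and> b \<in> {j, j'}} \<le> vec_space.rank M X"
    by (rule vec_space.rank_gt_minor[OF X])
  then show False
    using r unfolding J two by simp
qed

lemma rank_le_1_minor:
  assumes "X \<in> carrier_mat M N" "vec_space.rank M X \<le> 1"
    and "i < M" "i' < M" "j < N" "j' < N"
  shows "X $$ (i, j) * X $$ (i', j') = X $$ (i, j') * X $$ (i', j)"
proof -
  have *: "X $$ (a, j) * X $$ (a', j') = X $$ (a, j') * X $$ (a', j)" if "a < a'" "a' < M" for a a'
  proof (cases j j' rule: linorder_cases)
    case less
    then show ?thesis
      by (rule rank_le_1_minor_less[OF assms(1,2) that _ assms(6)])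
  next
    case greater
    then show ?thesis
      by (rule rank_le_1_minor_less[OF assms(1,2) that _ assms(5), symmetric])
  qed simp
  show ?thesis
  proof (cases i i' rule: linorder_cases)
    case less
    then show ?thesis
      using assms(4) by (rule *)
  next
    case greater
    from *[OF greater assms(3)] show ?thesis
      by (simp only: mult.commute)
  qed (simp add: mult.commute)
qed

section \<open>Outer products and structured vectors\<close>

lemma dim_outer_prod [simp]:
  "dim_row (outer_prod u v) = dim_vec u" "dim_col (outer_prod u v) = dim_vec v"
  by (simp_all add: outer_prod_def)

lemma outer_prod_index:
  assumes "i < dim_vec u" "j < dim_vec v"
  shows "outer_prod u v $$ (i, j) = u $ i * v $ j"
  using assms by (simp add: outer_prod_def scalar_prod_def mat_of_cols_def mat_of_rows_def)

lemma rank_smult_outer_prod: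
  "vec_space.rank (dim_vec u) (c \<cdot>\<^sub>m outer_prod u v) \<le> 1"
  by (rule vec_space.rank_le_1_product_entries[where f = "\<lambda>i. c * u $ i" and g = "\<lambda>j. v $ j"])
    (auto simp: outer_prod_index)

lemma dim_struct_vec [simp]: "dim_vec (struct_vec n z) = n"
  by (simp add: struct_vec_def)

lemma struct_vec_index:
  "i < n \<Longrightarrow> struct_vec n z $ i = of_real (1 / sqrt (\<Sum>k<n. cmod z ^ (2 * k))) * z ^ i"
  by (simp add: struct_vec_def)

lemma struct_vec_denom_pos:
  assumes "n \<ge> 1"
  shows "(\<Sum>k<n. cmod z ^ (2 * k)) > 0"
  by (rule sum_pos2[where i = 0]) (use assms in auto)

lemma struct_vec_normalized:
  assumes "n \<ge> 1"
  shows "(\<Sum>i<n. (cmod (struct_vec n z $ i))\<^sup>2) = 1"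
proof -
  let ?s = "\<Sum>k<n. cmod z ^ (2 * k)"
  have s: "?s > 0"
    using assms by (rule struct_vec_denom_pos)
  have "(\<Sum>i<n. (cmod (struct_vec n z $ i))\<^sup>2) = (\<Sum>i<n. cmod z ^ (2 * i) / ?s)"
    using s by (intro sum.cong)
      (auto simp: struct_vec_index norm_mult norm_divide norm_power power_mult_distrib power_divide
        power_mult[symmetric] mult.commute)
  then show ?thesis
    using s by (simp add: sum_divide_distrib[symmetric])
qed

lemma struct_vec_0: "n \<ge> 1 \<Longrightarrow> struct_vec n 0 = unit_vec n 0"
proof (rule eq_vecI)
  fix i assume n: "n \<ge> 1" and i: "i < dim_vec (unit_vec n 0 :: complex vec)"
  have "(\<Sum>k<n. cmod 0 ^ (2 * k)) = (\<Sum>k\<in>{0}. cmod 0 ^ (2 * k))"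
    using n by (intro sum.mono_neutral_right) (auto simp: power_0_left)
  with i show "struct_vec n 0 $ i = unit_vec n 0 $ i"
    by (auto simp: struct_vec_index power_0_left)
qed simp

lemma hankel_struct_outer:
  "hankel_mat (c \<cdot>\<^sub>m outer_prod (struct_vec M z) (struct_vec N z))"
proof -
  let ?H = "c \<cdot>\<^sub>m outer_prod (struct_vec M z) (struct_vec N z)"
  \<comment> \<open>Both normalizing factors are constants, and the product of \<open>z ^ k\<close>
    and \<open>z ^ l\<close> depends only on \<open>k + l\<close>.\<close>
  let ?h = "\<lambda>k. c * (of_real (1 / sqrt (\<Sum>k<M. cmod z ^ (2 * k)))
      * of_real (1 / sqrt (\<Sum>k<N. cmod z ^ (2 * k)))) * z ^ k"
  have "?H = mat (dim_row ?H) (dim_col ?H) (\<lambda>(k, l). ?h (k + l))"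
    by (rule eq_matI) (auto simp: outer_prod_index struct_vec_index power_add)
  then show ?thesis
    unfolding hankel_mat_def by (rule exI[where x = ?h])
qed

text \<open>The split is on the top left entry \<open>h 0\<close>. If it is zero, the minors kill
  every antidiagonal except the last; otherwise they make \<open>h\<close> a geometric
  sequence.\<close>

lemma rank_1_hankel_cases:
  assumes M: "M \<ge> 2" and N: "N \<ge> 2"
    and X: "X \<in> carrier_mat M N" and h: "hankel_mat X" and r: "vec_space.rank M X \<le> 1"
  obtains c where "X = c \<cdot>\<^sub>m outer_prod (unit_vec M (M - 1)) (unit_vec N (N - 1))"
  | c z where "X = c \<cdot>\<^sub>m outer_prod (struct_vec M z) (struct_vec N z)"
proof -
  from h obtain h where "X = mat (dim_row X) (dim_col X) (\<lambda>(k, l). h (k + l))"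
    unfolding hankel_mat_def by blast
  then have Xh: "X = mat M N (\<lambda>(k, l). h (k + l))"
    using X by simp
  have minor: "h (i + j) * h (i' + j') = h (i + j') * h (i' + j)"
    if "i < M" "i' < M" "j < N" "j' < N" for i i' j j'
    using rank_le_1_minor[OF X r that] that by (simp add: Xh)
  show thesis
  proof (cases "h 0 = 0")
    case True
    have z: "h k = 0" if "k < M + N - 2" for k
      using that
    proof (induction k)
      case (Suc k)
      \<comment> \<open>Adjacent rows \<open>i\<close>, \<open>i + 1\<close> and columns
        \<open>j\<close>, \<open>j + 1\<close> are chosen with \<open>i + j = k\<close>. Their minor
        says that the square of \<open>h (k + 1)\<close> equals \<open>h k * h (k + 2)\<close>,
        which is 0. The cap \<open>M - 2\<close> keeps row \<open>i + 1\<close> inside the matrix,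
        and the bound on \<open>Suc k\<close> does so for column \<open>j + 1\<close>.\<close>
      define i where "i = min k (M - 2)"
      define j where "j = k - i"
      have ij: "k = i + j" "i + 1 < M" "j + 1 < N"
        using Suc.prems M N by (auto simp: i_def j_def)
      have "h (i + j) * h (i + 1 + (j + 1)) = h (i + (j + 1)) * h (i + 1 + j)"
        by (rule minor) (use ij in auto)
      moreover have "h (i + j) = 0"
        using Suc ij by simp
      ultimately show ?case
        using ij by simp
    qed (use True in simp)
    have "X = h (M + N - 2) \<cdot>\<^sub>m outer_prod (unit_vec M (M - 1)) (unit_vec N (N - 1))"
    proof (rule eq_matI)
      fix i j
      assume "i < dim_row (h (M + N - 2) \<cdot>\<^sub>m outer_prod (unit_vec M (M - 1)) (unit_vec N (N - 1)))"
        and "j < dim_col (h (M + N - 2) \<cdot>\<^sub>m outer_prod (unit_vec M (M - 1)) (unit_vec N (N - 1)))"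
      then have ij: "i < M" "j < N"
        by simp_all
      show "X $$ (i, j) = (h (M + N - 2) \<cdot>\<^sub>m outer_prod (unit_vec M (M - 1)) (unit_vec N (N - 1))) $$ (i, j)"
      proof (cases "i = M - 1 \<and> j = N - 1")
        case True
        then have "i + j = M + N - 2"
          using M N by simp
        then show ?thesis
          using True ij M N
          by (simp add: Xh outer_prod_index)
      next
        case False
        then have "i + j < M + N - 2"
          using ij by auto
        then show ?thesis
          using False z ij M N
          by (auto simp: Xh outer_prod_index)
      qed
    qed (use X in auto)
    then show thesis
      by (rule that(1))
  next
    case False
    \<comment> \<open>The ratio of the geometric sequence. The first column and the first row are
      treated separately; the minors with corner \<open>h 0\<close> then give all remaining
      entries.\<close>
    define z where "z = h 1 / h 0"
    have hM: "h i = h 0 * z ^ i" if "i < M" for i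
      using that
    proof (induction i)
      case (Suc i)
      have "h 0 * h (Suc i) = h 1 * h i"
        using minor[of 0 i 0 1] Suc.prems N by simp
      then show ?case
        using Suc False by (simp add: z_def field_simps)
    qed simp
    have hN: "h j = h 0 * z ^ j" if "j < N" for j
      using that
    proof (induction j)
      case (Suc j)
      have "h 0 * h (Suc j) = h j * h 1"
        using minor[of 0 1 0 j] Suc.prems M by (simp add: mult.commute)
      then show ?case
        using Suc False by (simp add: z_def field_simps)
    qed simp
    have hMN: "h (i + j) = h 0 * z ^ i * z ^ j" if "i < M" "j < N" for i j
    proof -
      have "h 0 * h (i + j) = h j * h i"
        using minor[of 0 i 0 j] that by simp
      then have "h 0 * h (i + j) = h 0 * (h 0 * z ^ i * z ^ j)"
        using hM[OF that(1)] hN[OF that(2)] by (simp add: ac_simps)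
      then show ?thesis
        using False by simp
    qed
    \<comment> \<open>The scalar has to cancel the normalizing factors of the two structured
      vectors.\<close>
    let ?p = "complex_of_real (sqrt (\<Sum>k<M. cmod z ^ (2 * k)))"
    let ?q = "complex_of_real (sqrt (\<Sum>k<N. cmod z ^ (2 * k)))"
    have pq: "?p \<noteq> 0" "?q \<noteq> 0"
      using struct_vec_denom_pos[of M z] struct_vec_denom_pos[of N z] M N by simp_all
    have "X = (h 0 * ?p * ?q) \<cdot>\<^sub>m outer_prod (struct_vec M z) (struct_vec N z)"
      by (rule eq_matI) (use X pq in
        \<open>auto simp: Xh hMN outer_prod_index struct_vec_index simp del: of_real_sum\<close>)
    then show thesis
      by (rule that(2))
  qed
qed

section \<open>Distance to multiples of a unit outer product\<close>

text \<open>Here \<open>e\<close> is a unit vector and \<open>s\<close> the inner product of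
  \<open>a\<close> with it; the formula comes from completing the square in \<open>c\<close>. The
  computation runs in the complex numbers, where a squared modulus is
  \<open>w * cnj w\<close>.\<close>

lemma sum_cmod_diff_mult_unit:
  fixes a e :: "'a \<Rightarrow> complex"
  assumes "(\<Sum>p\<in>P. (cmod (e p))\<^sup>2) = 1"
  defines "s \<equiv> \<Sum>p\<in>P. a p * cnj (e p)"
  shows "(\<Sum>p\<in>P. (cmod (a p - c * e p))\<^sup>2)
    = (\<Sum>p\<in>P. (cmod (a p))\<^sup>2) - (cmod s)\<^sup>2 + (cmod (c - s))\<^sup>2"
proof -
  have e: "(\<Sum>p\<in>P. e p * cnj (e p)) = 1"
    using arg_cong[OF assms(1), of complex_of_real] by (simp only: of_real_sum complex_norm_square of_real_1)
  have s': "(\<Sum>p\<in>P. cnj (a p) * e p) = cnj s"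
    by (simp add: s_def)
  have "complex_of_real (\<Sum>p\<in>P. (cmod (a p - c * e p))\<^sup>2)
    = (\<Sum>p\<in>P. a p * cnj (a p) - cnj c * (a p * cnj (e p)) - c * (cnj (a p) * e p)
        + c * cnj c * (e p * cnj (e p)))"
    unfolding of_real_sum complex_norm_square by (intro sum.cong) (auto simp: algebra_simps)
  also have "\<dots> = (\<Sum>p\<in>P. a p * cnj (a p)) - cnj c * s - c * cnj s + c * cnj c"
    by (simp only: sum.distrib sum_subtractf sum_distrib_left[symmetric] e s' s_def[symmetric]) simp
  also have "\<dots> = complex_of_real ((\<Sum>p\<in>P. (cmod (a p))\<^sup>2) - (cmod s)\<^sup>2 + (cmod (c - s))\<^sup>2)"
    unfolding of_real_add of_real_diff of_real_sum complex_norm_square by (simp add: algebra_simps)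
  finally show ?thesis
    using of_real_eq_iff by blast
qed

lemma bilinear_form_eq_sum:
  assumes "A \<in> carrier_mat M N" "dim_vec u = M" "dim_vec v = N"
  shows "conjugate u \<bullet> (A *\<^sub>v conjugate v)
    = (\<Sum>i<M. \<Sum>j<N. A $$ (i, j) * cnj (u $ i * v $ j))"
  using assms
  by (auto simp: scalar_prod_def lessThan_atLeast0 sum_distrib_left conjugate_complex_def ac_simps
      intro!: sum.cong)

lemma frobenius_diff_unit_outer:
  assumes A: "A \<in> carrier_mat M N" and u: "dim_vec u = M" and v: "dim_vec v = N"
    and u1: "(\<Sum>i<M. (cmod (u $ i))\<^sup>2) = 1" and v1: "(\<Sum>j<N. (cmod (v $ j))\<^sup>2) = 1"
  defines "s \<equiv> conjugate u \<bullet> (A *\<^sub>v conjugate v)"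
  shows "(frobenius_norm (A - c \<cdot>\<^sub>m outer_prod u v))\<^sup>2
    = (frobenius_norm A)\<^sup>2 - (cmod s)\<^sup>2 + (cmod (c - s))\<^sup>2"
proof -
  \<comment> \<open>Matrices become vectors indexed by positions. The vector \<open>?e\<close> of
    the outer product has norm 1, being a product of unit vectors.\<close>
  let ?P = "{..<M} \<times> {..<N}"
  let ?e = "\<lambda>(i, j). u $ i * v $ j"
  have "(\<Sum>p\<in>?P. (cmod (?e p))\<^sup>2) = (\<Sum>i<M. \<Sum>j<N. (cmod (u $ i))\<^sup>2 * (cmod (v $ j))\<^sup>2)"
    by (simp add: sum.cartesian_product norm_mult power_mult_distrib case_prod_beta)
  also have "\<dots> = 1"
    by (simp add: sum_distrib_left[symmetric] sum_distrib_right[symmetric] u1 v1)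
  finally have e: "(\<Sum>p\<in>?P. (cmod (?e p))\<^sup>2) = 1" .
  have s: "s = (\<Sum>p\<in>?P. A $$ p * cnj (?e p))"
    unfolding s_def bilinear_form_eq_sum[OF A u v]
    by (simp add: sum.cartesian_product case_prod_beta)
  have fA: "(frobenius_norm A)\<^sup>2 = (\<Sum>p\<in>?P. (cmod (A $$ p))\<^sup>2)"
    using A by (simp add: frobenius_norm_def sum_nonneg sum.cartesian_product case_prod_beta)
  have "(frobenius_norm (A - c \<cdot>\<^sub>m outer_prod u v))\<^sup>2
    = (\<Sum>i<M. \<Sum>j<N. (cmod ((A - c \<cdot>\<^sub>m outer_prod u v) $$ (i, j)))\<^sup>2)"
    using A u v by (simp add: frobenius_norm_def sum_nonneg)
  also have "\<dots> = (\<Sum>i<M. \<Sum>j<N. (cmod (A $$ (i, j) - c * (u $ i * v $ j)))\<^sup>2)"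
    using A u v by (intro sum.cong) (auto simp: outer_prod_index)
  also have "\<dots> = (\<Sum>p\<in>?P. (cmod (A $$ p - c * ?e p))\<^sup>2)"
    by (simp add: sum.cartesian_product case_prod_beta)
  finally show ?thesis
    using sum_cmod_diff_mult_unit[OF e, of "\<lambda>p. A $$ p" c] fA s by simp
qed

section \<open>Values, continuity and inversion symmetry of the coefficient\<close>

lemma struct_coeff_eq_sum:
  assumes "A \<in> carrier_mat M N"
  shows "struct_coeff A z
    = (\<Sum>i<M. \<Sum>j<N. A $$ (i, j) * cnj (struct_vec M z $ i * struct_vec N z $ j))"
  unfolding struct_coeff_def carrier_matD[OF assms] by (rule bilinear_form_eq_sum[OF assms]) simp_all

text \<open>Evaluates the coefficient at \<open>z = 0\<close> (first unit vectors) and at the point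
  at infinity (last unit vectors).\<close>

lemma bilinear_form_unit_vec:
  fixes A :: "complex mat"
  assumes A: "A \<in> carrier_mat M N" and i: "i < M" and j: "j < N"
  shows "conjugate (unit_vec M i) \<bullet> (A *\<^sub>v conjugate (unit_vec N j)) = A $$ (i, j)"
proof -
  have "conjugate (unit_vec M i) \<bullet> (A *\<^sub>v conjugate (unit_vec N j))
    = (\<Sum>k<M. \<Sum>l<N. if l = j then if k = i then A $$ (k, l) else 0 else 0)"
    unfolding bilinear_form_eq_sum[OF A index_unit_vec(3) index_unit_vec(3)]
    by (intro sum.cong refl) (simp add: i j)
  then show ?thesis
    using i j by simp
qed

lemma struct_coeff_0:
  assumes "A \<in> carrier_mat M N" "M \<ge> 1" "N \<ge> 1"
  shows "struct_coeff A 0 = A $$ (0, 0)"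
  using assms bilinear_form_unit_vec[OF assms(1), of 0 0] by (simp add: struct_coeff_def struct_vec_0)

lemma continuous_on_struct_vec_index:
  assumes "i < n"
  shows "continuous_on S (\<lambda>z. struct_vec n z $ i)"
proof -
  have "(\<Sum>k<n. cmod z ^ (2 * k)) \<noteq> 0" for z
    using struct_vec_denom_pos[of n z] assms by simp
  then show ?thesis
    unfolding struct_vec_index[OF assms] by (intro continuous_intros) auto
qed

lemma continuous_on_struct_coeff:
  assumes "A \<in> carrier_mat M N"
  shows "continuous_on S (struct_coeff A)"
  unfolding struct_coeff_eq_sum[OF assms, abs_def]
  by (intro continuous_intros continuous_on_struct_vec_index) auto

text \<open>Taking \<open>z ^ (n - 1)\<close> out of the powers of \<open>z\<close> leaves the
  powers of \<open>inverse z\<close> in reverse order. Normalization absorbs the modulus of that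
  factor, so only its phase \<open>sgn z ^ (n - 1)\<close> remains.\<close>

lemma struct_vec_inverse_index:
  assumes z: "z \<noteq> 0" and i: "i < n"
  shows "struct_vec n z $ i = sgn z ^ (n - 1) * struct_vec n (inverse z) $ (n - Suc i)"
proof -
  let ?s = "\<lambda>z. \<Sum>k<n. cmod z ^ (2 * k)"
  have "?s z = (\<Sum>k<n. cmod z ^ (2 * (n - Suc k)))"
    by (rule sum.nat_diff_reindex[symmetric])
  also have "\<dots> = (\<Sum>k<n. (cmod z ^ (n - 1))\<^sup>2 * cmod (inverse z) ^ (2 * k))"
  proof (rule sum.cong)
    fix k assume "k \<in> {..<n}"
    then have "2 * (n - 1) = 2 * (n - Suc k) + 2 * k"
      by auto
    then have "(cmod z ^ (n - 1))\<^sup>2 = cmod z ^ (2 * (n - Suc k)) * cmod z ^ (2 * k)"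
      by (simp add: power_add[symmetric] power_mult[symmetric] ac_simps)
    then show "cmod z ^ (2 * (n - Suc k)) = (cmod z ^ (n - 1))\<^sup>2 * cmod (inverse z) ^ (2 * k)"
      using z by (simp add: norm_inverse power_inverse)
  qed simp
  finally have "?s z = (cmod z ^ (n - 1))\<^sup>2 * ?s (inverse z)"
    by (simp add: sum_distrib_left)
  then have s: "sqrt (?s z) = cmod z ^ (n - 1) * sqrt (?s (inverse z))"
    by (simp add: real_sqrt_mult)
  have "z ^ (n - 1) = z ^ i * z ^ (n - Suc i)"
    using i by (simp add: power_add[symmetric])
  then have p: "z ^ (n - 1) * inverse z ^ (n - Suc i) = z ^ i"
    using z by (simp add: power_inverse)
  have "sgn z ^ (n - 1) = z ^ (n - 1) / of_real (cmod z ^ (n - 1))"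
    by (simp add: sgn_eq power_divide)
  then show ?thesis
    using i p by (simp only: struct_vec_index[OF i] struct_vec_index[of "n - Suc i" n] s p[symmetric])
      (simp add: struct_vec_index)
qed

text \<open>The phases from the two vectors form a common factor of modulus 1; reindexing both sums
  moves the reversal onto the entries of \<open>A\<close>.\<close>

lemma cmod_struct_coeff_inverse:
  assumes A: "A \<in> carrier_mat M N" and z: "z \<noteq> 0"
  shows "cmod (struct_coeff A z)
    = cmod (struct_coeff (mat M N (\<lambda>(i, j). A $$ (M - Suc i, N - Suc j))) (inverse z))"
proof -
  let ?B = "mat M N (\<lambda>(i, j). A $$ (M - Suc i, N - Suc j))"
  let ?\<omega> = "cnj (sgn z ^ (M - 1) * sgn z ^ (N - 1))"
  let ?g = "\<lambda>i j. A $$ (i, j) * cnj (struct_vec M (inverse z) $ (M - Suc i) *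
      struct_vec N (inverse z) $ (N - Suc j))"
  have "struct_coeff A z = ?\<omega> * (\<Sum>i<M. \<Sum>j<N. ?g i j)"
    unfolding struct_coeff_eq_sum[OF A] sum_distrib_left
  proof (intro sum.cong refl)
    fix i j assume "i \<in> {..<M}" "j \<in> {..<N}"
    then show "A $$ (i, j) * cnj (struct_vec M z $ i * struct_vec N z $ j) = ?\<omega> * ?g i j"
      using struct_vec_inverse_index[OF z, of i M] struct_vec_inverse_index[OF z, of j N] by simp
  qed
  also have "(\<Sum>i<M. \<Sum>j<N. ?g i j) = (\<Sum>i<M. \<Sum>j<N. ?g (M - Suc i) (N - Suc j))"
    by (rule trans[OF sum.nat_diff_reindex[symmetric]],
        rule sum.cong[OF refl], rule sum.nat_diff_reindex[symmetric])
  also have "\<dots> = struct_coeff ?B (inverse z)"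
    by (subst struct_coeff_eq_sum[of _ M N]) (auto intro!: sum.cong simp: Suc_diff_Suc)
  finally show ?thesis
    using z by (simp add: norm_mult norm_power norm_sgn)
qed

section \<open>Existence of a maximizer\<close>

lemma struct_coeff_arg_max_exists:
  assumes M: "M \<ge> 1" and N: "N \<ge> 1" and A: "A \<in> carrier_mat M N"
    and corner: "cmod (A $$ (M - 1, N - 1)) \<le> cmod (A $$ (0, 0))"
  shows "\<exists>z. \<forall>w. cmod (struct_coeff A w) \<le> cmod (struct_coeff A z)"
proof -
  define B where "B = mat M N (\<lambda>(i, j). A $$ (M - Suc i, N - Suc j))"
  have B: "B \<in> carrier_mat M N"
    by (simp add: B_def)
  \<comment> \<open>The plane is not compact, so the maximum is taken on the closed unit disc, once
    for \<open>A\<close> and once for the reversed matrix \<open>B\<close>; the latter covers the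
    exterior of the disc.\<close>
  have "\<exists>x\<in>cball 0 1. \<forall>y\<in>cball 0 1. cmod (struct_coeff C y) \<le> cmod (struct_coeff C x)"
    if "C \<in> carrier_mat M N" for C
    using that by (intro continuous_attains_sup continuous_on_norm continuous_on_struct_coeff) auto
  then obtain a b where a: "\<And>y. cmod y \<le> 1 \<Longrightarrow> cmod (struct_coeff A y) \<le> cmod (struct_coeff A a)"
    and b: "\<And>y. cmod y \<le> 1 \<Longrightarrow> cmod (struct_coeff B y) \<le> cmod (struct_coeff B b)"
    using A B by (metis mem_cball_0)
  have inv: "cmod (struct_coeff A z) = cmod (struct_coeff B (inverse z))" if "z \<noteq> 0" for z
    using cmod_struct_coeff_inverse[OF A that] by (simp add: B_def)
  \<comment> \<open>The best value of \<open>B\<close> has to be matched by \<open>A\<close> at a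
    finite point. That point is \<open>inverse b\<close>, unless \<open>b = 0\<close>: then the
    value is the last corner entry, which \<open>A\<close> dominates at 0.\<close>
  obtain c where c: "cmod (struct_coeff B b) \<le> cmod (struct_coeff A c)"
  proof (cases "b = 0")
    case True
    have "struct_coeff B b = A $$ (M - 1, N - 1)"
      using struct_coeff_0[OF B] M N True by (simp add: B_def)
    then show thesis
      using that[of 0] struct_coeff_0[OF A] M N corner by simp
  next
    case False
    then show thesis
      using that[of "inverse b"] inv[of "inverse b"] by simp
  qed
  have le: "cmod (struct_coeff A w) \<le> max (cmod (struct_coeff A a)) (cmod (struct_coeff A c))" for w
  proof (cases "cmod w \<le> 1")
    case True
    then show ?thesis
      using a[of w] by simp
  next
    case False
    then have "w \<noteq> 0" "cmod (inverse w) \<le> 1"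
      by (auto simp: norm_inverse inverse_le_1_iff)
    then show ?thesis
      using inv[of w] b[of "inverse w"] c by simp
  qed
  show ?thesis
  proof (cases "cmod (struct_coeff A a) \<le> cmod (struct_coeff A c)")
    case True
    then show ?thesis
      using le by (metis max.absorb2)
  next
    case False
    then show ?thesis
      using le by (metis linear max.absorb1)
  qed
qed

section \<open>Optimality of the maximizing coefficient\<close>

lemma sum_cmod_unit_vec:
  assumes "i < n"
  shows "(\<Sum>k<n. (cmod (unit_vec n i $ k))\<^sup>2) = 1"
proof -
  have "(\<Sum>k<n. (cmod (unit_vec n i $ k))\<^sup>2) = (\<Sum>k<n. if k = i then 1 else 0)"
    by (intro sum.cong) (use assms in auto)
  then show ?thesis
    using assms by simp
qed

theorem theorem3p1:
  fixes A :: "complex mat" and M N :: nat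
  assumes "M \<ge> 2" and "N \<ge> 2"
    and "A \<in> carrier_mat M N"
    and "cmod (A $$ (0, 0)) \<ge> cmod (A $$ (M - 1, N - 1))"
    and "vec_space.rank M A \<ge> 1"
  shows "(\<exists>z. is_arg_max (\<lambda>w. cmod (struct_coeff A w)) (\<lambda>_. True) z) \<and>
    (\<forall>z. is_arg_max (\<lambda>w. cmod (struct_coeff A w)) (\<lambda>_. True) z \<longrightarrow>
       optimal_rank1_hankel A
         (struct_coeff A z \<cdot>\<^sub>m outer_prod (struct_vec M z) (struct_vec N z)))"
proof (intro conjI allI impI)
  have MN: "M \<ge> 1" "N \<ge> 1"
    using assms(1,2) by simp_all
  note A = assms(3)
  show "\<exists>z. is_arg_max (\<lambda>w. cmod (struct_coeff A w)) (\<lambda>_. True) z"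
    using struct_coeff_arg_max_exists[OF MN A assms(4)] by (simp add: is_arg_max_linorder)
  fix z
  assume "is_arg_max (\<lambda>w. cmod (struct_coeff A w)) (\<lambda>_. True) z"
  then have max: "cmod (struct_coeff A w) \<le> cmod (struct_coeff A z)" for w
    by (simp add: is_arg_max_linorder)
  let ?H = "struct_coeff A z \<cdot>\<^sub>m outer_prod (struct_vec M z) (struct_vec N z)"
  have dist: "(frobenius_norm (A - c \<cdot>\<^sub>m outer_prod (struct_vec M w) (struct_vec N w)))\<^sup>2
      = (frobenius_norm A)\<^sup>2 - (cmod (struct_coeff A w))\<^sup>2 + (cmod (c - struct_coeff A w))\<^sup>2" for c w
    using frobenius_diff_unit_outer[OF A, of "struct_vec M w" "struct_vec N w" c]
      struct_vec_normalized MN A by (simp add: struct_coeff_def)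
  \<comment> \<open>The scalar of \<open>?H\<close> is the coefficient itself, so the last square in
    \<open>dist\<close> vanishes.\<close>
  have dist_H: "(frobenius_norm (A - ?H))\<^sup>2 = (frobenius_norm A)\<^sup>2 - (cmod (struct_coeff A z))\<^sup>2"
    by (simp add: dist)
  have opt: "frobenius_norm (A - ?H) \<le> frobenius_norm (A - X)"
    if X: "X \<in> carrier_mat M N" "hankel_mat X" "vec_space.rank M X \<le> 1" for X
  proof (rule power2_le_imp_le)
    show "(frobenius_norm (A - ?H))\<^sup>2 \<le> (frobenius_norm (A - X))\<^sup>2"
      using rank_1_hankel_cases[OF assms(1,2) X]
    proof cases
      case (1 c)
      let ?a = "A $$ (M - 1, N - 1)"
      have "(frobenius_norm (A - X))\<^sup>2 = (frobenius_norm A)\<^sup>2 - (cmod ?a)\<^sup>2 + (cmod (c - ?a))\<^sup>2"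
        unfolding 1 using MN
        by (subst frobenius_diff_unit_outer[OF A])
          (auto simp: bilinear_form_unit_vec[OF A] sum_cmod_unit_vec simp del: index_unit_vec)
      \<comment> \<open>The last corner is bounded by the first, which is the coefficient at 0 and
        hence at most the maximum.\<close>
      moreover have "(cmod ?a)\<^sup>2 \<le> (cmod (struct_coeff A z))\<^sup>2"
        using assms(4) max[of 0] by (intro power_mono) (auto simp: struct_coeff_0[OF A MN])
      ultimately show ?thesis
        using dist_H zero_le_power2[of "cmod (c - ?a)"] by linarith
    next
      case (2 c w)
      have "(cmod (struct_coeff A w))\<^sup>2 \<le> (cmod (struct_coeff A z))\<^sup>2"
        using max by (intro power_mono) auto
      then show ?thesis
        unfolding 2 dist_H using dist[of c w] zero_le_power2[of "cmod (c - struct_coeff A w)"] by linarith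
    qed
  qed (simp add: frobenius_norm_def sum_nonneg)
  show "optimal_rank1_hankel A ?H"
    unfolding optimal_rank1_hankel_def is_arg_min_linorder
    using A opt hankel_struct_outer rank_smult_outer_prod[of "struct_vec M z"] by auto
qed

end
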